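(* Let $R$ be a finite commutative ring with unity, let $n,m\ge 1$ be integers, and let $K\subseteq R[x_1,\dots,x_n]$ be an $R$-submodule which extends $R$. Then the expected number of distinct common zeros in $R^n$ of a system of random polynomials $f_1,\dots,f_m\in K$ is $|R|^{n-m}$. Explicitly, for an integer $0\le r\le |R|^n$ let $A_r\subseteq K^m$ be the set of $m$-tuples $(f_1,\dots,f_m)$ such that $\#\{\mathbf{p}\in R^n : f_1(\mathbf{p})=\cdots=f_m(\mathbf{p})=0\}=r$. If $K$ is finitely generated, then $$\sum_{r=0}^{|R|^n} r\,\frac{|A_r|}{|K^m|}=|R|^{n-m},$$ and if $K$ is infinitely generated, then the densities $d_m(A_r)$ exist and $$\sum_{r=0}^{|R|^n} r\, d_m(A_r)=|R|^{n-m}.$$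
   Context: An $R$-submodule $K\subseteq R[x_1,\dots,x_n]$ is said to extend $R$ if it is free as an $R$-module and contains the constant polynomials, equivalently $1_R\in K$. A free module is called finitely generated if it has finite rank and infinitely generated otherwise. When $K$ is finitely generated (hence finite), a random system is drawn from $K^m$ with respect to the normalized counting measure. When $K$ is infinitely generated, probability is interpreted as asymptotic density: for an integer $t\ge 0$ let $K_t\subseteq K$ be the $R$-submodule of polynomials in $K$ of total degree at most $t$ (including $0$); for $A\subseteq K^m$ the density is $d_m(A)=\lim_{t\to\infty}|A\cap K_t^m|/|K_t^m|$, provided the limit exists. The number $|R|^{n-m}$ is a rational number, possibly less than $1$. *)

theory Defs
  imports Complex_Main "HOL-Library.Poly_Mapping" "HOL-Library.FuncSet"
    "HOL-Library.Cardinality"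
begin

text \<open>
  The sort \<open>{comm_ring, comm_monoid_mult}\<close> is that of commutative rings with unity. It is used
  instead of \<open>comm_ring_1\<close>, whose axiom \<open>0 \<noteq> 1\<close> excludes the zero ring. The locale \<open>module\<close> of
  the library presupposes \<open>comm_ring_1\<close>, so its notions of submodule, linear independence and
  span are restated here for this sort.

  A polynomial in variables indexed by the finite type \<open>'n\<close> is a finitely supported map from
  exponent vectors to coefficients; thus the number of variables is \<open>CARD('n)\<close>.
\<close>

type_synonym ('n, 'a) mvpoly = "('n \<Rightarrow>\<^sub>0 nat) \<Rightarrow>\<^sub>0 'a"

definition poly_const :: "'a::zero \<Rightarrow> ('n, 'a) mvpoly"
  where "poly_const c = Poly_Mapping.single 0 c"

definition poly_scale :: "'a::{comm_ring, comm_monoid_mult} \<Rightarrow> ('n, 'a) mvpoly \<Rightarrow> ('n, 'a) mvpoly"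
  where "poly_scale c f = Poly_Mapping.map ((*) c) f"

definition poly_eval ::
  "('n::finite, 'a::{comm_ring, comm_monoid_mult}) mvpoly \<Rightarrow> ('n \<Rightarrow> 'a) \<Rightarrow> 'a"
  where "poly_eval f p =
    (\<Sum>s\<in>Poly_Mapping.keys f. Poly_Mapping.lookup f s * (\<Prod>i\<in>UNIV. p i ^ Poly_Mapping.lookup s i))"

text \<open>Only meaningful for nonzero polynomials.\<close>

definition total_degree :: "('n::finite, 'a::zero) mvpoly \<Rightarrow> nat"
  where "total_degree f = Max ((\<lambda>s. \<Sum>i\<in>UNIV. Poly_Mapping.lookup s i) ` Poly_Mapping.keys f)"

definition poly_submodule :: "('n, 'a::{comm_ring, comm_monoid_mult}) mvpoly set \<Rightarrow> bool"
  where "poly_submodule K \<longleftrightarrow>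
    0 \<in> K \<and> (\<forall>f\<in>K. \<forall>g\<in>K. f + g \<in> K) \<and> (\<forall>c. \<forall>f\<in>K. poly_scale c f \<in> K)"

definition poly_independent :: "('n, 'a::{comm_ring, comm_monoid_mult}) mvpoly set \<Rightarrow> bool"
  where "poly_independent B \<longleftrightarrow>
    (\<forall>T u. finite T \<and> T \<subseteq> B \<and> (\<Sum>b\<in>T. poly_scale (u b) b) = 0 \<longrightarrow> (\<forall>b\<in>T. u b = 0))"

definition poly_span :: "('n, 'a::{comm_ring, comm_monoid_mult}) mvpoly set \<Rightarrow> ('n, 'a) mvpoly set"
  where "poly_span B = {\<Sum>b\<in>T. poly_scale (u b) b | T u. finite T \<and> T \<subseteq> B}"

definition poly_basis ::
  "('n, 'a::{comm_ring, comm_monoid_mult}) mvpoly set \<Rightarrow> ('n, 'a) mvpoly set \<Rightarrow> bool"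
  where "poly_basis B K \<longleftrightarrow> poly_independent B \<and> poly_span B = K"

definition extends_ring :: "('n, 'a::{comm_ring, comm_monoid_mult}) mvpoly set \<Rightarrow> bool"
  where "extends_ring K \<longleftrightarrow>
    poly_submodule K \<and> (\<exists>B. poly_basis B K) \<and> (\<forall>c. poly_const c \<in> K)"

definition finite_rank :: "('n, 'a::{comm_ring, comm_monoid_mult}) mvpoly set \<Rightarrow> bool"
  where "finite_rank K \<longleftrightarrow> (\<exists>B. finite B \<and> poly_basis B K)"

text \<open>Tuples are indexed by \<open>0, \<dots>, m - 1\<close>; extensionality makes them canonical, so that
  \<open>card (tuples m K)\<close> is the cardinality of \<open>K\<^sup>m\<close>.\<close>

definition tuples :: "nat \<Rightarrow> 'b set \<Rightarrow> (nat \<Rightarrow> 'b) set"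
  where "tuples m K = {..<m} \<rightarrow>\<^sub>E K"

definition common_zeros ::
  "nat \<Rightarrow> (nat \<Rightarrow> ('n::finite, 'a::{comm_ring, comm_monoid_mult}) mvpoly) \<Rightarrow> ('n \<Rightarrow> 'a) set"
  where "common_zeros m F = {p. \<forall>i<m. poly_eval (F i) p = 0}"

definition systems_with_zeros ::
  "nat \<Rightarrow> ('n::finite, 'a::{comm_ring, comm_monoid_mult}) mvpoly set \<Rightarrow> nat
    \<Rightarrow> (nat \<Rightarrow> ('n, 'a) mvpoly) set"
  where "systems_with_zeros m K r = {F \<in> tuples m K. card (common_zeros m F) = r}"

definition degree_le_part :: "('n::finite, 'a::zero) mvpoly set \<Rightarrow> nat \<Rightarrow> ('n, 'a) mvpoly set"
  where "degree_le_part K t = {f \<in> K. f = 0 \<or> total_degree f \<le> t}"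

definition density_seq ::
  "nat \<Rightarrow> ('n::finite, 'a::zero) mvpoly set \<Rightarrow> (nat \<Rightarrow> ('n, 'a) mvpoly) set \<Rightarrow> nat \<Rightarrow> real"
  where "density_seq m K A t =
    real (card (A \<inter> tuples m (degree_le_part K t))) / real (card (tuples m (degree_le_part K t)))"

definition density_exists ::
  "nat \<Rightarrow> ('n::finite, 'a::zero) mvpoly set \<Rightarrow> (nat \<Rightarrow> ('n, 'a) mvpoly) set \<Rightarrow> bool"
  where "density_exists m K A \<longleftrightarrow> convergent (density_seq m K A)"

definition density ::
  "nat \<Rightarrow> ('n::finite, 'a::zero) mvpoly set \<Rightarrow> (nat \<Rightarrow> ('n, 'a) mvpoly) set \<Rightarrow> real"
  where "density m K A = lim (density_seq m K A)"

end

theory Submission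
  imports Defs "HOL-Library.Function_Algebras"
begin

text \<open>
  Evaluation at a point \<open>p\<close> is an additive map from polynomials to \<open>R\<close>, and it maps the constants
  onto \<open>R\<close>. On a finite group \<open>G\<close> of polynomials containing the constants, all its fibres therefore
  have the same size, so a random element of \<open>G\<close> vanishes at \<open>p\<close> with probability \<open>1 / |R|\<close>, and
  \<open>m\<close> independent ones vanish there simultaneously with probability \<open>1 / |R|\<^sup>m\<close>. Linearity of
  expectation over the \<open>|R|\<^sup>n\<close> points gives \<open>|R|\<^sup>n\<^sup>-\<^sup>m\<close> expected common zeros, however dependent the
  events at different points may be (\<open>expected_common_zeros\<close>).

  If \<open>K\<close> has finite rank, then \<open>K\<close> is itself such a group. In general every truncation
  \<open>K\<^sub>t\<close> is one, so the expectation is \<open>|R|\<^sup>n\<^sup>-\<^sup>m\<close> for each \<open>t\<close>, and only the existence of the limits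
  remains. The number of zeros of a system depends only on the functions \<open>R\<^sup>n \<rightarrow> R\<close> that its
  members induce. Passing to induced functions is additive too, hence has equal fibres on
  \<open>K\<^sub>t\<close>, so the proportion of systems with \<open>r\<close> zeros is determined by the set of functions induced
  by \<open>K\<^sub>t\<close> (\<open>systems_ratio_eq_value_ratio\<close>). These sets increase with \<open>t\<close> inside a finite set, so
  they stabilise, and the proportions are eventually constant
  (\<open>density_seq_eventually_const\<close>).
\<close>

section \<open>Fibres of additive maps on finite groups\<close>

definition add_subgroup :: "'b::ab_group_add set \<Rightarrow> bool"
  where "add_subgroup G \<longleftrightarrow> 0 \<in> G \<and> (\<forall>x\<in>G. \<forall>y\<in>G. x + y \<in> G \<and> x - y \<in> G)"

text \<open>Translation by any preimage of \<open>v\<close> maps the kernel bijectively onto the fibre over \<open>v\<close>.\<close>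

lemma card_fibre_eq_card_kernel:
  assumes "add_subgroup G" and "additive h" and "v \<in> h ` G"
  shows "card {x \<in> G. h x = v} = card {x \<in> G. h x = 0}"
proof -
  interpret additive h by fact
  from assms(3) obtain g where g: "g \<in> G" "h g = v" by blast
  have "bij_betw (\<lambda>x. x + g) {x \<in> G. h x = 0} {x \<in> G. h x = v}"
    by (rule bij_betw_byWitness[where f' = "\<lambda>x. x - g"])
      (use g assms(1) in \<open>auto simp: add_subgroup_def add diff\<close>)
  then show ?thesis by (simp add: bij_betw_same_card)
qed

lemma card_group_eq_card_image_times_kernel:
  assumes "add_subgroup G" and "finite G" and "additive h"
  shows "card G = card (h ` G) * card {x \<in> G. h x = 0}"
proof -
  have "card G = (\<Sum>v\<in>h ` G. card {x \<in> G. h x = v})"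
    using assms(2) sum.group[of G "h ` G" h "\<lambda>_. 1::nat"] by simp
  then show ?thesis
    using card_fibre_eq_card_kernel[OF assms(1,3)] by simp
qed

text \<open>
  A tuple of values has one fibre per coordinate, so the tuples above it form a product of
  \<open>m\<close> fibres, each as large as the kernel.
\<close>

lemma card_tuples_with_values:
  assumes "add_subgroup G" and "finite G" and "additive h"
  shows "card {F \<in> tuples m G. Q (\<lambda>i\<in>{..<m}. h (F i))}
    = card {v \<in> tuples m (h ` G). Q v} * card {x \<in> G. h x = 0} ^ m"
proof -
  define c where "c F = (\<lambda>i\<in>{..<m}. h (F i))" for F :: "nat \<Rightarrow> 'a"
  let ?S = "{F \<in> tuples m G. Q (c F)}" and ?V = "{v \<in> tuples m (h ` G). Q v}"
  have "finite (tuples m G)" "finite (tuples m (h ` G))"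
    using assms(2) by (auto simp: tuples_def intro!: finite_PiE)
  then have fin: "finite ?S" "finite ?V" by simp_all
  have img: "c ` ?S \<subseteq> ?V" by (auto simp: tuples_def c_def PiE_iff)
  have fibre: "card {F \<in> ?S. c F = v} = card {x \<in> G. h x = 0} ^ m" if "v \<in> ?V" for v
  proof -
    have v: "v \<in> extensional {..<m}" "\<And>i. i < m \<Longrightarrow> v i \<in> h ` G"
      using that unfolding tuples_def by (simp_all add: PiE_iff)
    have "{F \<in> ?S. c F = v} = (\<Pi>\<^sub>E i\<in>{..<m}. {x \<in> G. h x = v i})" (is "?L = ?R")
    proof (intro equalityI subsetI)
      fix F assume "F \<in> ?L"
      then show "F \<in> ?R" by (auto simp: tuples_def c_def PiE_iff)
    next
      fix F assume F: "F \<in> ?R"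
      then have "c F = v"
        using v(1) by (intro extensionalityI[of _ "{..<m}"]) (auto simp: c_def PiE_iff)
      with F that show "F \<in> ?L" by (auto simp: tuples_def PiE_iff)
    qed
    then show ?thesis
      using card_fibre_eq_card_kernel[OF assms(1,3)] v(2) by (simp add: card_PiE)
  qed
  have "card ?S = (\<Sum>v\<in>?V. card {F \<in> ?S. c F = v})"
    using sum.group[OF fin img, of "\<lambda>_. 1::nat"] by simp
  then show ?thesis using fibre by (simp add: c_def)
qed

lemma card_tuples: "card (tuples m G) = card G ^ m"
  by (simp add: tuples_def card_PiE)

section \<open>Evaluation of polynomials\<close>

lemma poly_eval_superset:
  fixes f :: "('n::finite, 'a::{comm_ring, comm_monoid_mult}) mvpoly"
  assumes "finite S" and "Poly_Mapping.keys f \<subseteq> S"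
  shows "poly_eval f p =
    (\<Sum>s\<in>S. Poly_Mapping.lookup f s * (\<Prod>i\<in>UNIV. p i ^ Poly_Mapping.lookup s i))"
  unfolding poly_eval_def
  by (rule sum.mono_neutral_left) (use assms in \<open>auto simp: in_keys_iff\<close>)

lemma poly_eval_add:
  fixes f g :: "('n::finite, 'a::{comm_ring, comm_monoid_mult}) mvpoly"
  shows "poly_eval (f + g) p = poly_eval f p + poly_eval g p"
proof -
  let ?S = "Poly_Mapping.keys f \<union> Poly_Mapping.keys g"
  have "finite ?S" "Poly_Mapping.keys (f + g) \<subseteq> ?S"
    by (simp_all add: keys_add)
  then show ?thesis
    by (simp add: poly_eval_superset[of ?S] lookup_add distrib_right sum.distrib)
qed

lemma poly_eval_const:
  "poly_eval (poly_const c :: ('n::finite, 'a::{comm_ring, comm_monoid_mult}) mvpoly) p = c"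
  by (simp add: poly_eval_def poly_const_def)

lemma additive_poly_eval_at: "additive (\<lambda>f. poly_eval f p)"
  by (simp add: additive_def poly_eval_add)

lemma additive_poly_eval: "additive poly_eval"
  by (simp add: additive_def poly_eval_add fun_eq_iff)

section \<open>The expected number of common zeros\<close>

text \<open>
  Linearity of expectation, written as a double count of the pairs of a system in \<open>G\<^sup>m\<close> and a
  common zero of it.
\<close>

lemma expected_common_zeros:
  fixes G :: "('n::finite, 'a::{finite, comm_ring, comm_monoid_mult}) mvpoly set"
  assumes "add_subgroup G" and "finite G" and "\<And>c. poly_const c \<in> G"
  shows "(\<Sum>r=0..CARD('a) ^ CARD('n).
      real r * (real (card (systems_with_zeros m G r)) / real (card (tuples m G))))
    = real CARD('a) powi (int CARD('n) - int m)"
proof -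
  let ?T = "tuples m G" and ?N = "CARD('a) ^ CARD('n)" and ?z = "\<lambda>F. card (common_zeros m F)"
  define k where "k p = card {f \<in> G. poly_eval f p = 0}" for p :: "'n \<Rightarrow> 'a"
  have finT: "finite ?T" using assms(2) by (auto simp: tuples_def intro!: finite_PiE)
  have points: "card (UNIV :: ('n \<Rightarrow> 'a) set) = ?N" by (simp add: card_fun)
  have le: "?z F \<le> ?N" for F :: "nat \<Rightarrow> ('n, 'a) mvpoly"
    unfolding points[symmetric] by (rule card_mono) auto
  have kernel: "card G = CARD('a) * k p" for p
  proof -
    have "(\<lambda>f. poly_eval f p) ` G = UNIV"
      using assms(3) poly_eval_const by (metis UNIV_eq_I image_eqI)
    then show ?thesis
      using card_group_eq_card_image_times_kernel[OF assms(1,2) additive_poly_eval_at, of p]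
      by (simp add: k_def)
  qed
  have vanish: "card {F \<in> ?T. p \<in> common_zeros m F} = k p ^ m" for p
  proof -
    have "{F \<in> ?T. p \<in> common_zeros m F} = tuples m {f \<in> G. poly_eval f p = 0}"
      unfolding tuples_def common_zeros_def by (simp add: PiE_iff set_eq_iff) blast
    then show ?thesis by (simp add: card_tuples k_def)
  qed
  have "(\<Sum>r=0..?N. r * card (systems_with_zeros m G r)) = (\<Sum>r\<in>{0..?N}. sum ?z {F \<in> ?T. ?z F = r})"
    by (simp add: systems_with_zeros_def mult.commute)
  also have "\<dots> = (\<Sum>F\<in>?T. ?z F)"
    by (rule sum.group) (use finT le in auto)
  also have "\<dots> = (\<Sum>F\<in>?T. \<Sum>p\<in>UNIV. if p \<in> common_zeros m F then 1 else 0)"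
    by (simp add: sum.If_cases)
  also have "\<dots> = (\<Sum>p\<in>UNIV. \<Sum>F\<in>?T. if p \<in> common_zeros m F then 1 else 0)"
    by (rule sum.swap)
  also have "\<dots> = (\<Sum>p\<in>UNIV. k p ^ m)"
    using finT by (simp add: sum.If_cases vanish[symmetric] Collect_conj_eq)
  finally have count: "(\<Sum>r=0..?N. r * card (systems_with_zeros m G r)) = (\<Sum>p\<in>UNIV. k p ^ m)" .
  have "card G > 0" using assms(1,2) by (auto simp: card_gt_0_iff add_subgroup_def)
  then have prob: "real (k p ^ m) / real (card ?T) = 1 / real CARD('a) ^ m" for p
    using kernel[of p] by (simp add: card_tuples power_mult_distrib)
  have "(\<Sum>r=0..?N. real r * (real (card (systems_with_zeros m G r)) / real (card ?T)))
      = real (\<Sum>r=0..?N. r * card (systems_with_zeros m G r)) / real (card ?T)"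
    by (simp add: sum_divide_distrib)
  also have "\<dots> = (\<Sum>p\<in>(UNIV :: ('n \<Rightarrow> 'a) set). real (k p ^ m) / real (card ?T))"
    unfolding count by (simp add: sum_divide_distrib)
  also have "\<dots> = real ?N / real CARD('a) ^ m"
    unfolding prob by (simp add: points)
  also have "\<dots> = real CARD('a) powi (int CARD('n) - int m)"
    by (simp add: power_int_diff)
  finally show ?thesis .
qed

section \<open>Submodules and their truncations\<close>

lemma poly_scale_minus_one:
  fixes f :: "('n, 'a::{comm_ring, comm_monoid_mult}) mvpoly"
  shows "poly_scale (- 1) f = - f"
  by (rule poly_mapping_eqI) (simp add: poly_scale_def map.rep_eq when_def)

lemma add_subgroup_poly_submodule:
  fixes K :: "('n, 'a::{comm_ring, comm_monoid_mult}) mvpoly set"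
  assumes "poly_submodule K"
  shows "add_subgroup K"
proof -
  have "f - g \<in> K" if "f \<in> K" "g \<in> K" for f g
  proof -
    have "f + poly_scale (- 1) g \<in> K"
      using assms that unfolding poly_submodule_def by blast
    then show ?thesis by (simp add: poly_scale_minus_one)
  qed
  then show ?thesis using assms by (auto simp: add_subgroup_def poly_submodule_def)
qed

text \<open>
  Bounding the degree of every monomial makes the zero polynomial an ordinary case, so that
  closure under addition reduces to an inclusion of supports.
\<close>

lemma degree_le_part_iff_keys:
  "f \<in> degree_le_part K t \<longleftrightarrow>
    f \<in> K \<and> (\<forall>s\<in>Poly_Mapping.keys f. (\<Sum>i\<in>UNIV. Poly_Mapping.lookup s i) \<le> t)"
  by (cases "f = 0") (simp_all add: degree_le_part_def total_degree_def)

lemma add_subgroup_degree_le_part: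
  fixes K :: "('n::finite, 'a::{comm_ring, comm_monoid_mult}) mvpoly set"
  assumes "add_subgroup K"
  shows "add_subgroup (degree_le_part K t)"
proof -
  have "Poly_Mapping.keys (f + g) \<subseteq> Poly_Mapping.keys f \<union> Poly_Mapping.keys g"
    "Poly_Mapping.keys (f - g) \<subseteq> Poly_Mapping.keys f \<union> Poly_Mapping.keys g"
    for f g :: "('n, 'a) mvpoly"
    by (simp_all add: keys_add keys_diff)
  then show ?thesis
    using assms unfolding add_subgroup_def Ball_def degree_le_part_iff_keys
    by (simp add: subset_iff) blast
qed

lemma poly_const_in_degree_le_part:
  assumes "poly_const c \<in> K"
  shows "poly_const c \<in> degree_le_part K t"
  using assms by (auto simp: degree_le_part_iff_keys poly_const_def split: if_splits)

lemma finite_exponents_degree_le: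
  "finite {s :: 'n::finite \<Rightarrow>\<^sub>0 nat. (\<Sum>i\<in>UNIV. Poly_Mapping.lookup s i) \<le> t}" (is "finite ?E")
proof (rule inj_on_finite)
  show "inj_on Poly_Mapping.lookup ?E" by (simp add: inj_on_def lookup_inject)
  have "Poly_Mapping.lookup s i \<le> (\<Sum>i\<in>UNIV. Poly_Mapping.lookup s i)"
    for s :: "'n \<Rightarrow>\<^sub>0 nat" and i
    by (rule member_le_sum) simp_all
  then show "Poly_Mapping.lookup ` ?E \<subseteq> (\<Pi>\<^sub>E i\<in>UNIV. {..t})"
    by (fastforce simp: PiE_iff intro: order_trans)
  show "finite (\<Pi>\<^sub>E i\<in>(UNIV :: 'n set). {..t})" by (intro finite_PiE) auto
qed

lemma finite_degree_le_part:
  fixes K :: "('n::finite, 'a::{finite, comm_ring, comm_monoid_mult}) mvpoly set"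
  shows "finite (degree_le_part K t)"
proof (rule inj_on_finite)
  let ?E = "{s :: 'n \<Rightarrow>\<^sub>0 nat. (\<Sum>i\<in>UNIV. Poly_Mapping.lookup s i) \<le> t}"
  show "inj_on Poly_Mapping.lookup (degree_le_part K t)" by (simp add: inj_on_def lookup_inject)
  show "Poly_Mapping.lookup ` degree_le_part K t
      \<subseteq> {u. \<forall>s. (s \<in> ?E \<longrightarrow> u s \<in> (UNIV :: 'a set)) \<and> (s \<notin> ?E \<longrightarrow> u s = 0)}"
    by (auto simp: degree_le_part_iff_keys simp flip: not_in_keys_iff_lookup_eq_zero)
  show "finite {u. \<forall>s. (s \<in> ?E \<longrightarrow> u s \<in> (UNIV :: 'a set)) \<and> (s \<notin> ?E \<longrightarrow> u s = 0)}"
    by (intro finite_set_of_finite_funs finite_exponents_degree_le) simp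
qed

lemma finite_of_finite_rank:
  fixes K :: "('n, 'a::{finite, comm_ring, comm_monoid_mult}) mvpoly set"
  assumes "finite_rank K"
  shows "finite K"
proof -
  obtain B where B: "finite B" "K = poly_span B"
    using assms by (auto simp: finite_rank_def poly_basis_def)
  let ?comb = "\<lambda>(T, u). \<Sum>b\<in>T. poly_scale (u b :: 'a) b"
  have "K \<subseteq> ?comb ` (Pow B \<times> (B \<rightarrow>\<^sub>E UNIV))"
  proof
    fix f assume "f \<in> K"
    then obtain T u where T: "T \<subseteq> B" "f = (\<Sum>b\<in>T. poly_scale (u b) b)"
      by (auto simp: B poly_span_def)
    then have "f = ?comb (T, restrict u B)" by (auto intro!: sum.cong)
    moreover have "(T, restrict u B) \<in> Pow B \<times> (B \<rightarrow>\<^sub>E UNIV)"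
      using T(1) by (simp add: PiE_iff)
    ultimately show "f \<in> ?comb ` (Pow B \<times> (B \<rightarrow>\<^sub>E UNIV))" by (rule image_eqI)
  qed
  moreover have "finite (Pow B \<times> (B \<rightarrow>\<^sub>E (UNIV :: 'a set)))"
    using B(1) by (auto intro!: finite_PiE)
  ultimately show ?thesis by (meson finite_imageI finite_subset)
qed

section \<open>Existence of the densities\<close>

text \<open>
  The kernel of \<open>poly_eval\<close> on \<open>G\<close> contributes the same factor to numerator and denominator. The
  right-hand side depends on \<open>G\<close> only through \<open>poly_eval ` G\<close>, whatever the size of \<open>G\<close>.
\<close>

lemma systems_ratio_eq_value_ratio:
  fixes G :: "('n::finite, 'a::{finite, comm_ring, comm_monoid_mult}) mvpoly set"
  assumes "add_subgroup G" and "finite G"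
  shows "real (card (systems_with_zeros m G r)) / real (card (tuples m G))
    = real (card {v \<in> tuples m (poly_eval ` G). card {p. \<forall>i<m. v i p = 0} = r})
      / real (card (tuples m (poly_eval ` G)))"
proof -
  let ?k = "card {f \<in> G. poly_eval f = 0}"
  let ?Q = "\<lambda>v :: nat \<Rightarrow> ('n \<Rightarrow> 'a) \<Rightarrow> 'a. card {p. \<forall>i<m. v i p = 0} = r"
  have "systems_with_zeros m G r = {F \<in> tuples m G. ?Q (\<lambda>i\<in>{..<m}. poly_eval (F i))}"
    by (simp add: systems_with_zeros_def common_zeros_def)
  then have num: "card (systems_with_zeros m G r) = card {v \<in> tuples m (poly_eval ` G). ?Q v} * ?k ^ m"
    using card_tuples_with_values[OF assms additive_poly_eval, of m ?Q] by simp
  have den: "card (tuples m G) = card (tuples m (poly_eval ` G)) * ?k ^ m"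
    using card_group_eq_card_image_times_kernel[OF assms additive_poly_eval]
    by (simp add: card_tuples power_mult_distrib)
  have "?k > 0"
    using assms additive.zero[OF additive_poly_eval]
    by (auto simp: card_gt_0_iff add_subgroup_def)
  then show ?thesis unfolding num den by simp
qed

text \<open>
  Each of the finitely many functions induced by \<open>K\<close> is induced by a polynomial of some degree,
  and the largest of these degrees suffices for all of them.
\<close>

lemma eventually_same_values:
  fixes K :: "('n::finite, 'a::{finite, comm_ring, comm_monoid_mult}) mvpoly set"
  shows "\<forall>\<^sub>F t in sequentially. poly_eval ` degree_le_part K t = poly_eval ` K"
proof -
  have "\<forall>\<^sub>F t in sequentially. v \<in> poly_eval ` degree_le_part K t" if v: "v \<in> poly_eval ` K" for v
  proof -
    obtain f where f: "f \<in> K" "v = poly_eval f" using v by blast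
    have "f \<in> degree_le_part K t" if "t \<ge> total_degree f" for t
      using f(1) that by (simp add: degree_le_part_def)
    then show ?thesis unfolding eventually_sequentially f(2) by blast
  qed
  then have "\<forall>\<^sub>F t in sequentially. \<forall>v\<in>poly_eval ` K. v \<in> poly_eval ` degree_le_part K t"
    by (intro eventually_ball_finite) auto
  then show ?thesis
    by (rule eventually_mono) (auto simp: degree_le_part_def)
qed

lemma density_seq_systems_with_zeros:
  "density_seq m K (systems_with_zeros m K r) t
    = real (card (systems_with_zeros m (degree_le_part K t) r))
      / real (card (tuples m (degree_le_part K t)))"
proof -
  have "systems_with_zeros m K r \<inter> tuples m (degree_le_part K t)
      = systems_with_zeros m (degree_le_part K t) r"
    unfolding systems_with_zeros_def tuples_def degree_le_part_def
    by (simp add: PiE_iff set_eq_iff) blast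
  then show ?thesis by (simp add: density_seq_def)
qed

lemma density_seq_eventually_const:
  fixes K :: "('n::finite, 'a::{finite, comm_ring, comm_monoid_mult}) mvpoly set"
  assumes "add_subgroup K"
  shows "\<exists>c. \<forall>\<^sub>F t in sequentially. density_seq m K (systems_with_zeros m K r) t = c"
proof -
  let ?ratio = "\<lambda>V :: (('n \<Rightarrow> 'a) \<Rightarrow> 'a) set.
    real (card {v \<in> tuples m V. card {p. \<forall>i<m. v i p = 0} = r}) / real (card (tuples m V))"
  have "density_seq m K (systems_with_zeros m K r) t = ?ratio (poly_eval ` degree_le_part K t)" for t
    unfolding density_seq_systems_with_zeros
    using assms by (intro systems_ratio_eq_value_ratio add_subgroup_degree_le_part finite_degree_le_part)
  then have "\<forall>\<^sub>F t in sequentially.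
      density_seq m K (systems_with_zeros m K r) t = ?ratio (poly_eval ` K)"
    using eventually_same_values[of K] by (simp add: eventually_mono)
  then show ?thesis ..
qed

section \<open>The two cases\<close>

theorem theorem2:
  fixes K :: "('n::finite, 'a::{finite, comm_ring, comm_monoid_mult}) mvpoly set"
    and m :: nat
  assumes "m \<ge> 1"
    and "extends_ring K"
  shows "(finite_rank K \<longrightarrow>
      (\<Sum>r=0..CARD('a) ^ CARD('n).
        real r * (real (card (systems_with_zeros m K r)) / real (card (tuples m K))))
      = real CARD('a) powi (int CARD('n) - int m)) \<and>
    (\<not> finite_rank K \<longrightarrow>
      (\<forall>r\<le>CARD('a) ^ CARD('n). density_exists m K (systems_with_zeros m K r)) \<and>
      (\<Sum>r=0..CARD('a) ^ CARD('n). real r * density m K (systems_with_zeros m K r))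
      = real CARD('a) powi (int CARD('n) - int m))"
proof (intro conjI impI)
  note K = \<open>extends_ring K\<close>[unfolded extends_ring_def]
  have G: "add_subgroup K" using K by (simp add: add_subgroup_poly_submodule)
  {
    assume "finite_rank K"
    then show "(\<Sum>r=0..CARD('a) ^ CARD('n).
        real r * (real (card (systems_with_zeros m K r)) / real (card (tuples m K))))
      = real CARD('a) powi (int CARD('n) - int m)"
      using G K by (intro expected_common_zeros finite_of_finite_rank) auto
  }
  have conv: "convergent (density_seq m K (systems_with_zeros m K r))" for r
    using density_seq_eventually_const[OF G, of m r] tendsto_eventually
    unfolding convergent_def by blast
  then show "\<forall>r\<le>CARD('a) ^ CARD('n). density_exists m K (systems_with_zeros m K r)"
    by (simp add: density_exists_def)
  have "(\<lambda>t. \<Sum>r=0..CARD('a) ^ CARD('n). real r * density_seq m K (systems_with_zeros m K r) t)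
      \<longlonglongrightarrow> (\<Sum>r=0..CARD('a) ^ CARD('n). real r * density m K (systems_with_zeros m K r))"
    using conv unfolding density_def convergent_LIMSEQ_iff by (intro tendsto_intros)
  moreover have "(\<Sum>r=0..CARD('a) ^ CARD('n). real r * density_seq m K (systems_with_zeros m K r) t)
      = real CARD('a) powi (int CARD('n) - int m)" for t
    unfolding density_seq_systems_with_zeros
    using G K by (intro expected_common_zeros add_subgroup_degree_le_part finite_degree_le_part
        poly_const_in_degree_le_part) auto
  ultimately show "(\<Sum>r=0..CARD('a) ^ CARD('n). real r * density m K (systems_with_zeros m K r))
      = real CARD('a) powi (int CARD('n) - int m)"
    by (simp add: LIMSEQ_const_iff)
qed

end
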